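(* Let $T$ be a rooted homogeneous tree of order $\gamma$ and let $B$ be the backward shift on $\mathcal{L}$. Then $\|B\|=2$ if $\gamma=1$, and $\|B\|=3\gamma-2$ if $\gamma\ge 2$.
   Context: A tree is an undirected graph (no loops or multiple edges) in which any two vertices are joined by exactly one path; $T$ also denotes its vertex set, which is assumed countably infinite, and every vertex has finite degree. $T$ has a distinguished vertex $o$, the root. For $v\neq o$, the parent $\mathrm{par}(v)$ is the vertex preceding $v$ on the unique path from $o$ to $v$; $\mathrm{Chi}(v)$ is the set of children of $v$ (vertices with parent $v$), and $\gamma(v)$ is its cardinality. $T$ is homogeneous of order $\gamma$ if $\gamma(v)=\gamma$ for all $v\in T$ (so $\gamma\geq 1$). For $f:T\to\mathbb{C}$ define $f'(o)=f(o)$ and $f'(v)=f(v)-f(\mathrm{par}(v))$ for $v\neq o$. The Lipschitz space $\mathcal{L}$ is the Banach space of all $f:T\to\mathbb{C}$ with $f'$ bounded, with norm $\|f\|=\sup_{v\in T}|f'(v)|$. The backward shift is $(Bf)(v)=\sum_{w\in\mathrm{Chi}(v)}f(w)$. *)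

theory Defs
  imports "HOL-Analysis.Analysis" "Graph_Theory.Arc_Walk"
begin

text \<open>
  As in the library, undirected graphs are symmetric digraphs: an edge is a pair of opposite arcs.
  The library's predicate \<open>tree\<close> forbids directed cycles, hence also opposite arcs, and does not
  fit this encoding. The absence of parallel arcs makes uniqueness of a path as a list of arcs the
  same as uniqueness as a list of vertices.
\<close>

locale rooted_tree =
  sym_digraph T + loopfree_digraph T + nomulti_digraph T
  for T :: "('a, 'b) pre_digraph" (structure) and r :: 'a +
  assumes unique_path:
      "\<And>u v. u \<in> verts T \<Longrightarrow> v \<in> verts T \<Longrightarrow> \<exists>!p. apath u p v"
    and countable_verts: "countable (verts T)"
    and infinite_verts: "infinite (verts T)"
    and locally_finite: "\<And>v. v \<in> verts T \<Longrightarrow> finite (out_arcs T v)"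
    and root_in_verts: "r \<in> verts T"

definition parent :: "('a, 'b) pre_digraph \<Rightarrow> 'a \<Rightarrow> 'a \<Rightarrow> 'a" where
  "parent T r v = tail T (last (THE p. pre_digraph.apath T r p v))"

definition children :: "('a, 'b) pre_digraph \<Rightarrow> 'a \<Rightarrow> 'a \<Rightarrow> 'a set" where
  "children T r v = {w \<in> verts T. w \<noteq> r \<and> parent T r w = v}"

definition homogeneous :: "('a, 'b) pre_digraph \<Rightarrow> 'a \<Rightarrow> nat \<Rightarrow> bool" where
  "homogeneous T r \<gamma> \<longleftrightarrow> (\<forall>v\<in>verts T. card (children T r v) = \<gamma>)"

definition tree_deriv :: "('a, 'b) pre_digraph \<Rightarrow> 'a \<Rightarrow> ('a \<Rightarrow> complex) \<Rightarrow> 'a \<Rightarrow> complex" where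
  "tree_deriv T r f v = (if v = r then f v else f v - f (parent T r v))"

text \<open>
  Functions on the vertex set are encoded as functions on the ambient type that vanish off the
  vertex set, so that equality and the pointwise operations are those of functions on the vertices.
\<close>

definition lipschitz_space :: "('a, 'b) pre_digraph \<Rightarrow> 'a \<Rightarrow> ('a \<Rightarrow> complex) set" where
  "lipschitz_space T r =
     {f. (\<forall>v. v \<notin> verts T \<longrightarrow> f v = 0) \<and> bounded (tree_deriv T r f ` verts T)}"

definition lipschitz_norm :: "('a, 'b) pre_digraph \<Rightarrow> 'a \<Rightarrow> ('a \<Rightarrow> complex) \<Rightarrow> real" where
  "lipschitz_norm T r f = (SUP v\<in>verts T. cmod (tree_deriv T r f v))"

text \<open>Vertices outside the tree have no children, so the shift again vanishes off the vertex set.\<close>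

definition backward_shift ::
    "('a, 'b) pre_digraph \<Rightarrow> 'a \<Rightarrow> ('a \<Rightarrow> complex) \<Rightarrow> 'a \<Rightarrow> complex" where
  "backward_shift T r f v = (\<Sum>w\<in>children T r v. f w)"

definition bounded_operator ::
    "('a, 'b) pre_digraph \<Rightarrow> 'a \<Rightarrow> (('a \<Rightarrow> complex) \<Rightarrow> ('a \<Rightarrow> complex)) \<Rightarrow> bool" where
  "bounded_operator T r A \<longleftrightarrow>
     (\<forall>f\<in>lipschitz_space T r. A f \<in> lipschitz_space T r) \<and>
     (\<forall>f\<in>lipschitz_space T r. \<forall>g\<in>lipschitz_space T r.
        A (\<lambda>v. f v + g v) = (\<lambda>v. A f v + A g v)) \<and>
     (\<forall>c. \<forall>f\<in>lipschitz_space T r. A (\<lambda>v. c * f v) = (\<lambda>v. c * A f v)) \<and>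
     (\<exists>K. \<forall>f\<in>lipschitz_space T r.
        lipschitz_norm T r (A f) \<le> K * lipschitz_norm T r f)"

text \<open>The supremum is taken in the reals and is only meaningful for a bounded operator.\<close>

definition operator_norm ::
    "('a, 'b) pre_digraph \<Rightarrow> 'a \<Rightarrow> (('a \<Rightarrow> complex) \<Rightarrow> ('a \<Rightarrow> complex)) \<Rightarrow> real" where
  "operator_norm T r A =
     (SUP f\<in>{f \<in> lipschitz_space T r. lipschitz_norm T r f \<le> 1}. lipschitz_norm T r (A f))"

end

theory Submission
  imports Defs
begin

text \<open>
  Write \<open>D f\<close> for the derivative of \<open>f\<close>. On a child \<open>w\<close> of \<open>v\<close> one has
  \<open>f w = f v + D f w\<close>, so \<open>B f v\<close> is \<open>\<gamma> * f v\<close> plus the sum of \<open>D f\<close> over the children of \<open>v\<close>.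
  At the root this expresses \<open>D (B f)\<close> through \<open>2 * \<gamma>\<close> values of \<open>D f\<close> (\<open>D f r = f r\<close>, taken
  \<open>\<gamma>\<close> times, and the values at the children). At \<open>v \<noteq> r\<close> with parent \<open>p\<close>, the terms \<open>\<gamma> * f v\<close>
  and \<open>\<gamma> * f p\<close> differ by \<open>\<gamma> * D f v\<close>. One copy of this cancels against the
  contribution of the child \<open>v\<close> of \<open>p\<close>, leaving

    \<open>D (B f) v = (\<gamma> - 1) * D f v + (\<Sum>w child of v. D f w) - (\<Sum>u sibling of v. D f u)\<close>,

  with \<open>(\<gamma> - 1) + \<gamma> + (\<gamma> - 1) = 3 * \<gamma> - 2\<close> terms. The triangle inequality bounds the norm by
  \<open>max (2 * \<gamma>) (3 * \<gamma> - 2)\<close>, which is \<open>2\<close> for \<open>\<gamma> = 1\<close> and \<open>3 * \<gamma> - 2\<close> for \<open>\<gamma> \<ge> 2\<close>.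

  The bounds are attained, because the values of \<open>D f\<close> can be prescribed freely: summing \<open>g\<close>
  along the path from the root gives a function with derivative \<open>g\<close>. For \<open>\<gamma> = 1\<close> take \<open>g = 1\<close>;
  for \<open>\<gamma> \<ge> 2\<close> fix a child \<open>v\<close> of the root and let \<open>g\<close> be \<open>-1\<close> on the siblings of \<open>v\<close> and \<open>1\<close>
  elsewhere.
\<close>

section \<open>Root paths, parents and children\<close>

context rooted_tree
begin

definition root_path :: "'a \<Rightarrow> 'b awalk" where
  "root_path v = (THE p. apath r p v)"

lemma root_path_unique:
  assumes "apath r p v"
  shows "root_path v = p"
proof -
  have "v \<in> verts T"
    using assms by (auto simp: apath_def)
  then show ?thesis
    unfolding root_path_def using assms unique_path[OF root_in_verts] by (blast intro: the1_equality)
qed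

lemma apath_root_path: "v \<in> verts T \<Longrightarrow> apath r (root_path v) v"
  unfolding root_path_def using theI'[OF unique_path[OF root_in_verts]] .

text \<open>
  A prefix of a path is a path, so deleting the last arc of the root path of \<open>v\<close> yields the root
  path of the parent of \<open>v\<close>.
\<close>

lemma root_path_snoc:
  assumes "v \<in> verts T" "v \<noteq> r"
  obtains a where "a \<in> arcs T" "head T a = v" "tail T a = parent T r v"
    "root_path v = root_path (parent T r v) @ [a]"
proof -
  have p: "apath r (root_path v) v"
    by (rule apath_root_path) fact
  then have "root_path v \<noteq> []"
    using assms by (auto simp: apath_Nil_iff)
  then obtain q a where qa: "root_path v = q @ [a]"
    using rev_exhaust by blast
  have tail: "tail T a = parent T r v"
    unfolding parent_def root_path_def[symmetric] qa by simp
  from p qa have ap: "apath r q (awlast r q)" "apath (awlast r q) [a] v"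
    by (auto simp: apath_append_iff)
  then have a: "a \<in> arcs T" "head T a = v" "awlast r q = tail T a"
    by (auto simp: apath_simps)
  with ap tail have "root_path (parent T r v) = q"
    by (auto intro: root_path_unique)
  with that a tail qa show thesis by simp
qed

lemma parent_in_verts: "v \<in> verts T \<Longrightarrow> v \<noteq> r \<Longrightarrow> parent T r v \<in> verts T"
  by (metis root_path_snoc tail_in_verts)

lemma children_in_verts: "children T r v \<subseteq> verts T"
  by (auto simp: children_def)

lemma children_outside: "v \<notin> verts T \<Longrightarrow> children T r v = {}"
  by (auto simp: children_def parent_in_verts)

lemma finite_children: "finite (children T r v)"
proof (cases "v \<in> verts T")
  case True
  have "children T r v \<subseteq> head T ` out_arcs T v"
  proof
    fix w assume "w \<in> children T r v"
    then have w: "w \<in> verts T" "w \<noteq> r" "parent T r w = v"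
      by (auto simp: children_def)
    then obtain a where "a \<in> arcs T" "head T a = w" "tail T a = v"
      using root_path_snoc by metis
    then show "w \<in> head T ` out_arcs T v" by auto
  qed
  then show ?thesis
    using locally_finite[OF True] finite_surj by blast
qed (simp add: children_outside)

section \<open>The derivative and its inverse\<close>

text \<open>
  Summing along root paths inverts the derivative: the vertices on the root path of \<open>v\<close> are those
  on the root path of its parent, followed by \<open>v\<close>. Every \<open>g\<close> thus occurs as a derivative.
\<close>

definition primitive :: "('a \<Rightarrow> complex) \<Rightarrow> 'a \<Rightarrow> complex" where
  "primitive g v =
     (if v \<in> verts T then sum_list (map g (awalk_verts r (root_path v))) else 0)"

lemma tree_deriv_primitive:
  assumes "v \<in> verts T"
  shows "tree_deriv T r (primitive g) v = g v"
proof (cases "v = r")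
  case True
  have "root_path r = []"
    by (rule root_path_unique) (simp add: apath_Nil_iff root_in_verts)
  with True show ?thesis
    by (simp add: tree_deriv_def primitive_def root_in_verts)
next
  case False
  obtain a where a: "head T a = v" "tail T a = parent T r v"
      "root_path v = root_path (parent T r v) @ [a]"
    using root_path_snoc[OF assms False] by metis
  have parent: "parent T r v \<in> verts T"
    by (rule parent_in_verts) (fact assms False)+
  have "awlast r (root_path (parent T r v)) = parent T r v"
    using apath_root_path[OF parent] by (auto simp: apath_def)
  then have "awalk_verts r (root_path v) = awalk_verts r (root_path (parent T r v)) @ [v]"
    using a by (cases "root_path (parent T r v) = []") (auto simp: awalk_verts_conv)
  with False assms parent show ?thesis
    by (simp add: tree_deriv_def primitive_def)
qed

lemma primitive_in_unit_ball:
  assumes "\<And>v. cmod (g v) \<le> 1"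
  shows "primitive g \<in> lipschitz_space T r" "lipschitz_norm T r (primitive g) \<le> 1"
proof -
  have "bounded (tree_deriv T r (primitive g) ` verts T)"
    unfolding bounded_iff using assms by (auto simp: tree_deriv_primitive)
  then show "primitive g \<in> lipschitz_space T r"
    by (simp add: lipschitz_space_def primitive_def)
  show "lipschitz_norm T r (primitive g) \<le> 1"
    unfolding lipschitz_norm_def using assms root_in_verts
    by (intro cSUP_least) (auto simp: tree_deriv_primitive)
qed

lemma tree_deriv_le_norm:
  assumes "f \<in> lipschitz_space T r" "v \<in> verts T"
  shows "cmod (tree_deriv T r f v) \<le> lipschitz_norm T r f"
proof -
  from assms(1) obtain K where "\<And>v. v \<in> verts T \<Longrightarrow> cmod (tree_deriv T r f v) \<le> K"
    by (auto simp: lipschitz_space_def bounded_iff)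
  then have "bdd_above ((\<lambda>v. cmod (tree_deriv T r f v)) ` verts T)"
    by (rule bdd_aboveI2)
  then show ?thesis
    unfolding lipschitz_norm_def using assms(2) by (rule cSUP_upper2) simp
qed

section \<open>The derivative of a shifted function\<close>

lemma backward_shift_eq:
  "backward_shift T r f v =
     of_nat (card (children T r v)) * f v + (\<Sum>w\<in>children T r v. tree_deriv T r f w)"
proof -
  have "backward_shift T r f v = (\<Sum>w\<in>children T r v. f v + tree_deriv T r f w)"
    unfolding backward_shift_def by (rule sum.cong) (auto simp: children_def tree_deriv_def)
  then show ?thesis by (simp add: sum.distrib)
qed

context
  fixes \<gamma> :: nat
  assumes homogeneous: "homogeneous T r \<gamma>"
begin

lemma card_children: "v \<in> verts T \<Longrightarrow> card (children T r v) = \<gamma>"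
  using homogeneous by (simp add: homogeneous_def)

lemma tree_deriv_backward_shift_root:
  "tree_deriv T r (backward_shift T r f) r =
     of_nat \<gamma> * tree_deriv T r f r + (\<Sum>w\<in>children T r r. tree_deriv T r f w)"
  using backward_shift_eq[of f r] by (simp add: tree_deriv_def card_children root_in_verts)

text \<open>
  The values of \<open>f\<close> itself drop out because \<open>v\<close> and its parent have equally many children.
\<close>

lemma tree_deriv_backward_shift_nonroot:
  assumes "v \<in> verts T" "v \<noteq> r"
  shows "tree_deriv T r (backward_shift T r f) v =
     (of_nat \<gamma> - 1) * tree_deriv T r f v + (\<Sum>w\<in>children T r v. tree_deriv T r f w)
       - (\<Sum>u\<in>children T r (parent T r v) - {v}. tree_deriv T r f u)"
proof -
  let ?p = "parent T r v" and ?D = "tree_deriv T r f"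
  have p: "?p \<in> verts T"
    by (rule parent_in_verts) fact+
  have "v \<in> children T r ?p"
    using assms by (simp add: children_def)
  then have siblings: "sum ?D (children T r ?p) = ?D v + sum ?D (children T r ?p - {v})"
    by (rule sum.remove[OF finite_children])
  have "tree_deriv T r (backward_shift T r f) v
      = of_nat \<gamma> * (f v - f ?p) + sum ?D (children T r v) - sum ?D (children T r ?p)"
    using assms p by (simp add: tree_deriv_def[of _ _ "backward_shift T r f"]
        backward_shift_eq card_children algebra_simps)
  also have "f v - f ?p = ?D v"
    using assms by (simp add: tree_deriv_def)
  finally show ?thesis
    unfolding siblings by (simp add: algebra_simps)
qed

section \<open>The upper bound\<close>

lemma tree_deriv_backward_shift_le:
  assumes f: "f \<in> lipschitz_space T r" and v: "v \<in> verts T"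
  shows "cmod (tree_deriv T r (backward_shift T r f) v)
    \<le> max (2 * real \<gamma>) (3 * real \<gamma> - 2) * lipschitz_norm T r f"
proof -
  let ?D = "tree_deriv T r f" and ?N = "lipschitz_norm T r f"
  have N: "0 \<le> ?N"
    using tree_deriv_le_norm[OF f v] norm_ge_zero order_trans by blast
  have sum_le: "cmod (sum ?D A) \<le> real (card A) * ?N" if "A \<subseteq> verts T" for A
    using that tree_deriv_le_norm[OF f] by (intro sum_norm_bound) auto
  have children_le: "cmod (sum ?D (children T r v)) \<le> real \<gamma> * ?N"
    using sum_le[OF children_in_verts, of v] v by (simp only: card_children)
  show ?thesis
  proof (cases "v = r")
    case True
    have "cmod (tree_deriv T r (backward_shift T r f) v)
        \<le> cmod (of_nat \<gamma> * ?D v) + cmod (sum ?D (children T r v))"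
      unfolding True tree_deriv_backward_shift_root by (rule norm_triangle_ineq)
    also have "\<dots> \<le> real \<gamma> * ?N + real \<gamma> * ?N"
      using tree_deriv_le_norm[OF f v] children_le
      by (intro add_mono) (auto simp: norm_mult intro: mult_left_mono)
    also have "\<dots> = 2 * real \<gamma> * ?N" by simp
    also have "\<dots> \<le> max (2 * real \<gamma>) (3 * real \<gamma> - 2) * ?N"
      using N by (intro mult_right_mono) auto
    finally show ?thesis .
  next
    case False
    let ?S = "children T r (parent T r v) - {v}"
    have in_siblings: "v \<in> children T r (parent T r v)"
      using v False by (simp add: children_def)
    have card: "card (children T r (parent T r v)) = \<gamma>"
      by (rule card_children[OF parent_in_verts[OF v False]])
    then have pos: "\<gamma> \<ge> 1"
      using in_siblings finite_children
      by (metis One_nat_def Suc_leI card_gt_0_iff empty_iff)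
    have card_S: "real (card ?S) = real \<gamma> - 1"
      using in_siblings pos by (simp add: card finite_children)
    have "cmod (tree_deriv T r (backward_shift T r f) v)
        \<le> cmod ((of_nat \<gamma> - 1) * ?D v) + cmod (sum ?D (children T r v)) + cmod (sum ?D ?S)"
      unfolding tree_deriv_backward_shift_nonroot[OF v False]
      by (rule order_trans[OF norm_triangle_ineq4 add_right_mono[OF norm_triangle_ineq]])
    also have "\<dots> \<le> (real \<gamma> - 1) * ?N + real \<gamma> * ?N + (real \<gamma> - 1) * ?N"
    proof (intro add_mono)
      have "cmod (of_nat \<gamma> - 1) = real \<gamma> - 1"
        using pos by (metis norm_of_nat of_nat_1 of_nat_diff)
      then show "cmod ((of_nat \<gamma> - 1) * ?D v) \<le> (real \<gamma> - 1) * ?N"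
        using tree_deriv_le_norm[OF f v] pos by (auto simp: norm_mult intro: mult_left_mono)
      show "cmod (sum ?D ?S) \<le> (real \<gamma> - 1) * ?N"
        using sum_le[of ?S] children_in_verts card_S by auto
    qed (rule children_le)
    also have "\<dots> = (3 * real \<gamma> - 2) * ?N"
      by (simp add: algebra_simps)
    also have "\<dots> \<le> max (2 * real \<gamma>) (3 * real \<gamma> - 2) * ?N"
      using N by (intro mult_right_mono) auto
    finally show ?thesis .
  qed
qed

lemma backward_shift_in_lipschitz_space:
  assumes "f \<in> lipschitz_space T r"
  shows "backward_shift T r f \<in> lipschitz_space T r"
proof -
  have "bounded (tree_deriv T r (backward_shift T r f) ` verts T)"
    unfolding bounded_iff using tree_deriv_backward_shift_le[OF assms] by blast
  then show ?thesis
    by (simp add: lipschitz_space_def backward_shift_def children_outside)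
qed

lemma norm_backward_shift_le:
  assumes "f \<in> lipschitz_space T r"
  shows "lipschitz_norm T r (backward_shift T r f)
    \<le> max (2 * real \<gamma>) (3 * real \<gamma> - 2) * lipschitz_norm T r f"
  unfolding lipschitz_norm_def[of _ _ "backward_shift T r f"]
  using tree_deriv_backward_shift_le[OF assms] root_in_verts by (intro cSUP_least) auto

lemma bounded_operator_backward_shift: "bounded_operator T r (backward_shift T r)"
  unfolding bounded_operator_def
  using backward_shift_in_lipschitz_space norm_backward_shift_le
  by (auto simp: backward_shift_def sum.distrib sum_distrib_left)

section \<open>Extremal functions\<close>

text \<open>
  One function of norm at most \<open>1\<close> and one vertex suffice to see that the upper bound is the
  operator norm; prescribing the derivative \<open>g\<close> provides the function.
\<close>

lemma operator_norm_backward_shiftI: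
  assumes g: "\<And>v. cmod (g v) \<le> 1" and v: "v \<in> verts T"
    and attained: "cmod (tree_deriv T r (backward_shift T r (primitive g)) v)
      = max (2 * real \<gamma>) (3 * real \<gamma> - 2)"
  shows "operator_norm T r (backward_shift T r) = max (2 * real \<gamma>) (3 * real \<gamma> - 2)"
proof -
  let ?K = "max (2 * real \<gamma>) (3 * real \<gamma> - 2)"
  let ?U = "{f \<in> lipschitz_space T r. lipschitz_norm T r f \<le> 1}"
  have le: "lipschitz_norm T r (backward_shift T r f) \<le> ?K" if "f \<in> ?U" for f
  proof -
    have "lipschitz_norm T r (backward_shift T r f) \<le> ?K * lipschitz_norm T r f"
      using that by (simp add: norm_backward_shift_le)
    also have "\<dots> \<le> ?K * 1"
      using that by (intro mult_left_mono) auto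
    finally show ?thesis by simp
  qed
  have g_in: "primitive g \<in> ?U"
    using primitive_in_unit_ball[of g] g by simp
  have "?K \<le> lipschitz_norm T r (backward_shift T r (primitive g))"
    unfolding attained[symmetric]
    using g_in v by (intro tree_deriv_le_norm backward_shift_in_lipschitz_space) auto
  with le[OF g_in] have "lipschitz_norm T r (backward_shift T r (primitive g)) = ?K"
    by (rule antisym)
  then show ?thesis
    unfolding operator_norm_def using g_in le by (intro cSup_eq_maximum) (auto intro!: image_eqI)
qed

lemma sum_tree_deriv_primitive:
  "A \<subseteq> verts T \<Longrightarrow> sum (tree_deriv T r (primitive g)) A = sum g A"
  by (rule sum.cong) (auto simp: tree_deriv_primitive)

lemma operator_norm_backward_shift_1:
  assumes "\<gamma> = 1"
  shows "operator_norm T r (backward_shift T r) = 2"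
proof -
  have "tree_deriv T r (backward_shift T r (primitive (\<lambda>_. 1))) r = 2"
    using assms
    by (simp add: tree_deriv_backward_shift_root sum_tree_deriv_primitive tree_deriv_primitive
        children_in_verts root_in_verts card_children)
  then have "operator_norm T r (backward_shift T r) = max (2 * real \<gamma>) (3 * real \<gamma> - 2)"
    using assms root_in_verts by (intro operator_norm_backward_shiftI[of "\<lambda>_. 1" r]) auto
  with assms show ?thesis by simp
qed

lemma operator_norm_backward_shift_ge_2:
  assumes "\<gamma> \<ge> 2"
  shows "operator_norm T r (backward_shift T r) = 3 * real \<gamma> - 2"
proof -
  have "children T r r \<noteq> {}"
    using card_children[OF root_in_verts] assms by auto
  then obtain v where v: "v \<in> children T r r" by blast
  then have v': "v \<in> verts T" "v \<noteq> r" "parent T r v = r"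
    by (auto simp: children_def)
  let ?S = "children T r r - {v}"
  define g :: "'a \<Rightarrow> complex" where "g u = (if u \<in> ?S then - 1 else 1)" for u
  \<comment> \<open>The children of \<open>v\<close> keep the value \<open>1\<close>: a common child of \<open>v\<close> and \<open>r\<close> would have two parents.\<close>
  have "sum g (children T r v) = (\<Sum>w\<in>children T r v. 1)"
    using v' by (intro sum.cong) (auto simp: g_def children_def)
  then have children: "sum g (children T r v) = of_nat \<gamma>"
    by (simp add: card_children v')
  have "card ?S = \<gamma> - 1"
    using v by (simp add: card_children finite_children root_in_verts)
  then have siblings: "sum g ?S = - (of_nat \<gamma> - 1)"
    using assms by (simp add: g_def of_nat_diff)
  have S: "?S \<subseteq> verts T"
    using children_in_verts by blast
  have "tree_deriv T r (backward_shift T r (primitive g)) v = of_real (3 * real \<gamma> - 2)"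
    using v' S children siblings
    by (simp add: tree_deriv_backward_shift_nonroot sum_tree_deriv_primitive
        tree_deriv_primitive children_in_verts) (simp add: g_def)
  then have "cmod (tree_deriv T r (backward_shift T r (primitive g)) v) = 3 * real \<gamma> - 2"
    using assms by (simp only: norm_of_real)
  moreover have "max (2 * real \<gamma>) (3 * real \<gamma> - 2) = 3 * real \<gamma> - 2"
    using assms by simp
  ultimately show ?thesis
    using operator_norm_backward_shiftI[of g v] v' by (simp add: g_def)
qed

end

end

theorem theorem5p1:
  fixes T :: "('a, 'b) pre_digraph" and r :: 'a and \<gamma> :: nat
  assumes "rooted_tree T r"
    and "homogeneous T r \<gamma>"
  shows "bounded_operator T r (backward_shift T r)
    \<and> (\<gamma> = 1 \<longrightarrow> operator_norm T r (backward_shift T r) = 2)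
    \<and> (\<gamma> \<ge> 2 \<longrightarrow> operator_norm T r (backward_shift T r) = 3 * real \<gamma> - 2)"
proof -
  interpret rooted_tree T r by fact
  show ?thesis
    using bounded_operator_backward_shift operator_norm_backward_shift_1
      operator_norm_backward_shift_ge_2 assms(2) by blast
qed

end
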